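(* Let $\alpha\in(0,1)$, let $\Omega\subset\mathbb{R}^N$ be a bounded Lipschitz domain, and let $\{p\}$ be a strictly increasing sequence of exponents $p>N/\alpha$ tending to $+\infty$. Then: (i) for $q>\frac{N}{\alpha}$, the functionals $E_{\alpha,p}:L^q(\Omega)\to[0,\infty]$ satisfy $\Gamma(L^q(\Omega))\text{-}\lim_{p\to+\infty}E_{\alpha,p}=E_{\alpha,\infty}$; (ii) for $q>\frac{2N}{\alpha}$, the functionals $E_{\alpha,p}:L^q(\Omega)\to[0,\infty]$ satisfy $\Gamma(L^q(\Omega))\text{-}\lim_{p\to+\infty}E_{\alpha,p}=\overline{E}_{\alpha,\infty}$.
   Context: A domain is a connected open set. For $0<s<1$ and $1\le p<\infty$, $W^{s,p}(\Omega)$ is the space of $u\in L^p(\Omega)$ with $[u]_{W^{s,p}(\Omega)}^p=\int_{\Omega\times\Omega}\frac{|u(x)-u(y)|^p}{|x-y|^{N+sp}}\,dx\,dy<\infty$. For $p>N/\alpha$ and $u\in L^q(\Omega)$, $$E_{\alpha,p}(u)=\begin{cases}\left(\int_{\Omega\times\Omega}\frac{|u(x)-u(y)|^p}{|x-y|^{\alpha p}}\,dx\,dy\right)^{1/p}&\text{if }u\in W^{s,p}(\Omega),\ s=\alpha-N/p,\\ \infty&\text{otherwise.}\end{cases}$$ $$E_{\alpha,\infty}(u)=\sup_{x,y\in\Omega,\,x\ne y}\frac{|u(x)-u(y)|}{|x-y|^{\alpha}},\qquad \overline{E}_{\alpha,\infty}(u)=\sup_{x,y\in\overline\Omega,\,x\ne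 y}\frac{|u(x)-u(y)|}{|x-y|^{\alpha}}$$ when the respective supremum is finite, and $\infty$ otherwise. Convention: elements of $L^q(\Omega)$ are identified up to null sets. The suprema are evaluated on the continuous representative of $u$ (extended continuously to $\overline\Omega$ in the case of $\overline{E}_{\alpha,\infty}$), and the value is $\infty$ if there is no such representative. $\Gamma$-convergence: for a metric space $X$, functionals $E_n:X\to\mathbb{R}\cup\{\infty\}$ $\Gamma(X)$-converge to $E:X\to\mathbb{R}\cup\{\infty\}$ if (a) for every $u\in X$ and every $u_n\to u$ in $X$, $E(u)\le\liminf_n E_n(u_n)$; and (b) for every $u\in X$ there is a sequence $u_n\to u$ in $X$ with $E(u)\ge\limsup_n E_n(u_n)$. Here $X=L^q(\Omega)$ with its norm metric. *)

theory Defs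
  imports "HOL-Analysis.Analysis" "HOL-Probability.Essential_Supremum"
begin

section \<open>Bounded Lipschitz domains\<close>

definition is_domain :: "'a::euclidean_space set \<Rightarrow> bool" where
  "is_domain \<Omega> \<longleftrightarrow> open \<Omega> \<and> connected \<Omega>"

text \<open>
  Near each boundary point, the set is the strict epigraph of a Lipschitz function in a suitable
  orthonormal coordinate system. The unit vector \<open>e\<close> is the vertical direction, \<open>x \<bullet> e\<close> the last
  coordinate of \<open>x\<close>, and \<open>x - (x \<bullet> e) *\<^sub>R e\<close> its projection to the hyperplane orthogonal to \<open>e\<close>,
  which plays the role of the first \<open>N - 1\<close> coordinates.
\<close>

definition lipschitz_boundary :: "'a::euclidean_space set \<Rightarrow> bool" where
  "lipschitz_boundary \<Omega> \<longleftrightarrow>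
    (\<forall>x0\<in>frontier \<Omega>. \<exists>r>0. \<exists>e. norm e = 1 \<and>
      (\<exists>L \<gamma>. L-lipschitz_on {y. y \<bullet> e = 0} \<gamma> \<and>
        \<Omega> \<inter> ball x0 r = {x \<in> ball x0 r. (\<gamma> (x - (x \<bullet> e) *\<^sub>R e) :: real) < x \<bullet> e}))"

definition bounded_lipschitz_domain :: "'a::euclidean_space set \<Rightarrow> bool" where
  "bounded_lipschitz_domain \<Omega> \<longleftrightarrow> is_domain \<Omega> \<and> bounded \<Omega> \<and> lipschitz_boundary \<Omega>"


section \<open>Lebesgue spaces modulo null sets\<close>

text \<open>
  Functions are total on the ambient space, but measurability and almost-everywhere equality
  refer to \<open>\<Omega>\<close> only, so the values of a representative outside \<open>\<Omega>\<close> are arbitrary.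
\<close>

definition ae_rel :: "'a::euclidean_space set \<Rightarrow> (('a \<Rightarrow> real) \<times> ('a \<Rightarrow> real)) set" where
  "ae_rel \<Omega> = {(u, v). u \<in> borel_measurable (lebesgue_on \<Omega>) \<and>
     v \<in> borel_measurable (lebesgue_on \<Omega>) \<and> (AE x in lebesgue_on \<Omega>. u x = v x)}"

definition rep :: "('a \<Rightarrow> real) set \<Rightarrow> 'a \<Rightarrow> real" where
  "rep U = (SOME u. u \<in> U)"

definition root_ennreal :: "real \<Rightarrow> ennreal \<Rightarrow> ennreal" where
  "root_ennreal p t = (if t = \<infinity> then \<infinity> else ennreal (enn2real t powr (1 / p)))"

definition Lp_norm :: "'a::euclidean_space set \<Rightarrow> ereal \<Rightarrow> ('a \<Rightarrow> real) \<Rightarrow> ennreal" where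
  "Lp_norm \<Omega> q u =
    (if q = \<infinity> then esssup (lebesgue_on \<Omega>) (\<lambda>x. ennreal \<bar>u x\<bar>)
     else root_ennreal (real_of_ereal q)
       (\<integral>\<^sup>+x. ennreal (\<bar>u x\<bar> powr real_of_ereal q) \<partial>lebesgue_on \<Omega>))"

text \<open>
  The classes belonging to different exponents are literally the same sets of functions,
  so that it makes sense to ask whether an element of one space lies in another.
\<close>

definition Lp_space :: "'a::euclidean_space set \<Rightarrow> ereal \<Rightarrow> ('a \<Rightarrow> real) set set" where
  "Lp_space \<Omega> q = {U \<in> borel_measurable (lebesgue_on \<Omega>) // ae_rel \<Omega>. Lp_norm \<Omega> q (rep U) < \<infinity>}"

definition Lp_dist ::
    "'a::euclidean_space set \<Rightarrow> ereal \<Rightarrow> ('a \<Rightarrow> real) set \<Rightarrow> ('a \<Rightarrow> real) set \<Rightarrow> real" where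
  "Lp_dist \<Omega> q U V = enn2real (Lp_norm \<Omega> q (\<lambda>x. rep U x - rep V x))"


section \<open>Fractional Sobolev spaces and the functionals\<close>

definition double_integral ::
    "'a::euclidean_space set \<Rightarrow> real \<Rightarrow> real \<Rightarrow> ('a \<Rightarrow> real) \<Rightarrow> ennreal" where
  "double_integral \<Omega> p \<beta> u =
    (\<integral>\<^sup>+(x, y). ennreal (\<bar>u x - u y\<bar> powr p / norm (x - y) powr \<beta>)
       \<partial>(lebesgue_on \<Omega> \<Otimes>\<^sub>M lebesgue_on \<Omega>))"

definition frac_sobolev :: "'a::euclidean_space set \<Rightarrow> real \<Rightarrow> real \<Rightarrow> ('a \<Rightarrow> real) set set" where
  "frac_sobolev \<Omega> s p =
    {U \<in> Lp_space \<Omega> (ereal p). double_integral \<Omega> p (real DIM('a) + s * p) (rep U) < \<infinity>}"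

definition E_fun :: "'a::euclidean_space set \<Rightarrow> real \<Rightarrow> real \<Rightarrow> ('a \<Rightarrow> real) set \<Rightarrow> ennreal" where
  "E_fun \<Omega> \<alpha> p U =
    (if U \<in> frac_sobolev \<Omega> (\<alpha> - real DIM('a) / p) p
     then root_ennreal p (double_integral \<Omega> p (\<alpha> * p) (rep U))
     else \<infinity>)"

definition holder_sup :: "real \<Rightarrow> 'a::euclidean_space set \<Rightarrow> ('a \<Rightarrow> real) \<Rightarrow> ennreal" where
  "holder_sup \<alpha> S u =
    (SUP (x, y) \<in> {(x, y). x \<in> S \<and> y \<in> S \<and> x \<noteq> y}. ennreal (\<bar>u x - u y\<bar> / norm (x - y) powr \<alpha>))"

text \<open>
  The values on \<open>\<Omega>\<close> of a representative that is continuous on the open set \<open>\<Omega>\<close> are unique, and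
  so are those on the closure if it is even continuous there. Hence the choice below is immaterial.
\<close>

definition E_inf :: "'a::euclidean_space set \<Rightarrow> real \<Rightarrow> ('a \<Rightarrow> real) set \<Rightarrow> ennreal" where
  "E_inf \<Omega> \<alpha> U =
    (if \<exists>u\<in>U. continuous_on \<Omega> u
     then holder_sup \<alpha> \<Omega> (SOME u. u \<in> U \<and> continuous_on \<Omega> u)
     else \<infinity>)"

definition E_inf_bar :: "'a::euclidean_space set \<Rightarrow> real \<Rightarrow> ('a \<Rightarrow> real) set \<Rightarrow> ennreal" where
  "E_inf_bar \<Omega> \<alpha> U =
    (if \<exists>u\<in>U. continuous_on (closure \<Omega>) u
     then holder_sup \<alpha> (closure \<Omega>) (SOME u. u \<in> U \<and> continuous_on (closure \<Omega>) u)
     else \<infinity>)"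


section \<open>Gamma-convergence\<close>

text \<open>
  The metric space is given by its carrier \<open>X\<close> and its distance \<open>d\<close>. The functionals take values in
  an arbitrary complete linear order such as \<open>ereal\<close> or \<open>ennreal\<close>.
\<close>

definition Gamma_converges ::
    "'x set \<Rightarrow> ('x \<Rightarrow> 'x \<Rightarrow> real) \<Rightarrow> (nat \<Rightarrow> 'x \<Rightarrow> 'b::complete_linorder) \<Rightarrow> ('x \<Rightarrow> 'b) \<Rightarrow> bool" where
  "Gamma_converges X d E F \<longleftrightarrow>
    (\<forall>u\<in>X. \<forall>v. (\<forall>n. v n \<in> X) \<and> (\<lambda>n. d (v n) u) \<longlonglongrightarrow> 0 \<longrightarrow> F u \<le> liminf (\<lambda>n. E n (v n))) \<and>
    (\<forall>u\<in>X. \<exists>v. (\<forall>n. v n \<in> X) \<and> (\<lambda>n. d (v n) u) \<longlonglongrightarrow> 0 \<and> limsup (\<lambda>n. E n (v n)) \<le> F u)"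

end

theory Submission
  imports Defs
begin

text \<open>
  Recovery sequences are constant: an \<open>\<alpha>\<close>-Hoelder function with constant \<open>K\<close> has
  \<open>E\<^sub>p \<le> K |\<Omega>|\<^bsup>2/p\<^esup>\<close>. For the lower bound let \<open>l\<close> be the limit inferior and \<open>K' > K > l\<close>. By
  Chebyshev's inequality, the set of pairs where the \<open>\<alpha>\<close>-Hoelder quotient of \<open>v\<^sub>n\<close> exceeds \<open>K'\<close> has
  measure at most \<open>(K/K')\<close> to the power \<open>p\<^sub>n\<close> for infinitely many \<open>n\<close>. Convergence in measure then
  shows that almost every pair satisfies the Hoelder condition for \<open>u\<close> with constant \<open>K'\<close>, hence
  with constant \<open>l\<close>. Such a \<open>u\<close> is Hoelder continuous on a dense set of full measure and extends to
  the closure of \<open>\<Omega>\<close>. Thus both limit functionals agree.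
\<close>

section \<open>Hoelder continuous representatives\<close>

text \<open>Nonempty open sets are not negligible, so none fits into the exceptional null set. This
  supplies good points arbitrarily close to any point of \<open>\<Omega>\<close>.\<close>

lemma AE_lebesgue_on_open_imp_ex:
  fixes S \<Omega> :: "'a::euclidean_space set"
  assumes "AE x in lebesgue_on \<Omega>. P x" "open S" "S \<noteq> {}" "S \<subseteq> \<Omega>" "\<Omega> \<in> sets lebesgue"
  shows "\<exists>x\<in>S. P x"
proof (rule ccontr)
  assume no: "\<not> (\<exists>x\<in>S. P x)"
  have "AE x in lebesgue. x \<in> \<Omega> \<longrightarrow> P x"
    using assms(1,5) by (simp add: AE_restrict_space_iff)
  then have "AE x in lebesgue. x \<notin> S"
    by (rule AE_mp) (use no assms(4) in auto)
  then have "S \<in> null_sets lebesgue"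
    using assms(2) by (subst AE_iff_null_sets) auto
  then have "negligible S"
    by (simp add: negligible_iff_null_sets)
  then show False
    using open_not_negligible assms(2,3) by blast
qed

text \<open>By continuity the points of disagreement form an open set; if it were nonempty, it would
  contain a point of agreement. Hence the choice of a continuous representative does not affect the
  limit functionals.\<close>

lemma AE_eq_continuous_imp_eq:
  fixes u v :: "'a::euclidean_space \<Rightarrow> real"
  assumes "open \<Omega>" "AE x in lebesgue_on \<Omega>. u x = v x"
    and "continuous_on \<Omega> u" "continuous_on \<Omega> v" "x \<in> \<Omega>"
  shows "u x = v x"
proof (rule ccontr)
  assume ne: "u x \<noteq> v x"
  let ?S = "\<Omega> \<inter> (\<lambda>y. u y - v y) -` (- {0})"
  have "continuous_on \<Omega> (\<lambda>y. u y - v y)"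
    using assms(3,4) by (rule continuous_on_diff)
  then have "open ?S"
    by (rule continuous_open_preimage) (use assms(1) in auto)
  moreover have "x \<in> ?S"
    using ne assms(5) by simp
  ultimately have "\<exists>y\<in>?S. u y = v y"
    by (intro AE_lebesgue_on_open_imp_ex[OF assms(2)]) (use assms(1) in \<open>blast | simp\<close>)+
  then show False by auto
qed

text \<open>On a dense set of full measure the estimate makes \<open>u\<close> uniformly continuous,
  so \<open>u\<close> extends to the closure. The constant \<open>L\<close> survives the extension
  unchanged, which is why passing to the closure costs nothing.\<close>

lemma holder_AE_imp_extension:
  fixes u :: "'a::euclidean_space \<Rightarrow> real"
  assumes "open \<Omega>" "0 < \<alpha>" "0 \<le> L"
    and hold: "AE x in lebesgue_on \<Omega>. AE y in lebesgue_on \<Omega>. \<bar>u x - u y\<bar> \<le> L * norm (x - y) powr \<alpha>"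
  obtains v where "continuous_on (closure \<Omega>) v" "AE x in lebesgue_on \<Omega>. u x = v x"
    "\<And>x y. x \<in> closure \<Omega> \<Longrightarrow> y \<in> closure \<Omega> \<Longrightarrow> \<bar>v x - v y\<bar> \<le> L * norm (x - y) powr \<alpha>"
proof -
  have \<Omega>[measurable]: "\<Omega> \<in> sets lebesgue" using assms(1) by simp
  define G where "G = {x\<in>\<Omega>. AE y in lebesgue_on \<Omega>. \<bar>u x - u y\<bar> \<le> L * norm (x - y) powr \<alpha>}"
  have AEG: "AE x in lebesgue_on \<Omega>. x \<in> G"
    using hold by (rule AE_mp) (auto simp: G_def space_restrict_space)
  have dense: "\<Omega> \<subseteq> closure G"
  proof
    fix x assume x: "x \<in> \<Omega>"
    show "x \<in> closure G"
      unfolding closure_approachable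
    proof safe
      fix e :: real assume "e > 0"
      then have "x \<in> \<Omega> \<inter> ball x e" using x by simp
      then have "\<exists>y\<in>\<Omega> \<inter> ball x e. y \<in> G"
        by (intro AE_lebesgue_on_open_imp_ex[OF AEG] open_Int assms(1) open_ball \<Omega>) blast+
      then show "\<exists>y\<in>G. dist y x < e" by (auto simp: dist_commute)
    qed
  qed
  have clG: "closure G = closure \<Omega>"
    using closure_mono[of G \<Omega>] closure_minimal[OF dense] by (auto simp: G_def)
  have holdG: "\<bar>u x - u x'\<bar> \<le> L * norm (x - x') powr \<alpha>" if "x \<in> G" "x' \<in> G" for x x'
  proof -
    \<comment> \<open>Two points of \<open>G\<close> need not be a good pair by definition, but
      almost every \<open>y\<close> is a good partner of both. Choosing such \<open>y\<close> closer
      and closer to \<open>x'\<close> makes the detour through \<open>y\<close> free in the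
      limit.\<close>
    have ae: "AE y in lebesgue_on \<Omega>. \<bar>u x - u y\<bar> \<le> L * norm (x - y) powr \<alpha> \<and>
        \<bar>u x' - u y\<bar> \<le> L * norm (x' - y) powr \<alpha>"
      using that by (auto simp: G_def)
    have ex: "\<exists>y\<in>\<Omega> \<inter> ball x' (inverse (real (Suc n))). \<bar>u x - u y\<bar> \<le> L * norm (x - y) powr \<alpha> \<and>
        \<bar>u x' - u y\<bar> \<le> L * norm (x' - y) powr \<alpha>" for n
    proof (intro AE_lebesgue_on_open_imp_ex[OF ae] open_Int assms(1) open_ball \<Omega>)
      have "x' \<in> \<Omega> \<inter> ball x' (inverse (real (Suc n)))"
        using that(2) by (simp add: G_def)
      then show "\<Omega> \<inter> ball x' (inverse (real (Suc n))) \<noteq> {}" by blast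
    qed blast
    then obtain y where y: "\<And>n. y n \<in> ball x' (inverse (real (Suc n)))"
      "\<And>n. \<bar>u x - u (y n)\<bar> \<le> L * norm (x - y n) powr \<alpha>"
      "\<And>n. \<bar>u x' - u (y n)\<bar> \<le> L * norm (x' - y n) powr \<alpha>"
      by (metis IntE)
    have lim: "y \<longlonglongrightarrow> x'"
    proof (rule metric_tendsto_imp_tendsto[OF LIMSEQ_inverse_real_of_nat])
      show "\<forall>\<^sub>F n in sequentially. dist (y n) x' \<le> dist (inverse (real (Suc n))) 0"
        using y(1) by (intro always_eventually allI) (simp add: dist_commute less_imp_le)
    qed
    have "(\<lambda>n. L * norm (x - y n) powr \<alpha> + L * norm (x' - y n) powr \<alpha>) \<longlonglongrightarrow>
        L * norm (x - x') powr \<alpha> + L * norm (x' - x') powr \<alpha>"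
      by (intro tendsto_intros lim) (use assms(2) in auto)
    then have "\<bar>u x - u x'\<bar> \<le> L * norm (x - x') powr \<alpha> + L * norm (x' - x') powr \<alpha>"
    proof (rule LIMSEQ_le_const)
      have "\<bar>u x - u x'\<bar> \<le> L * norm (x - y n) powr \<alpha> + L * norm (x' - y n) powr \<alpha>" for n
        using y(2,3)[of n] by linarith
      then show "\<exists>N. \<forall>n\<ge>N. \<bar>u x - u x'\<bar> \<le> L * norm (x - y n) powr \<alpha> + L * norm (x' - y n) powr \<alpha>"
        by blast
    qed
    then show ?thesis by simp
  qed
  have "uniformly_continuous_on G u"
    unfolding uniformly_continuous_on_def
  proof safe
    fix e :: real assume e: "e > 0"
    \<comment> \<open>Chosen so that \<open>d powr \<alpha> = e / (L + 1)\<close>. The added 1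
      covers \<open>L = 0\<close> and makes the final inequality strict.\<close>
    define d where "d = (e / (L + 1)) powr (1 / \<alpha>)"
    have d: "d > 0" using e assms(3) by (simp add: d_def)
    have "dist (u x') (u x) < e" if "x \<in> G" "x' \<in> G" "dist x' x < d" for x x'
    proof -
      have "norm (x' - x) powr \<alpha> \<le> d powr \<alpha>"
        using that(3) assms(2) by (intro powr_mono2) (auto simp: dist_norm)
      also have "\<dots> = e / (L + 1)"
        using e assms(2,3) by (simp add: d_def powr_powr)
      finally have "L * norm (x' - x) powr \<alpha> \<le> L * (e / (L + 1))"
        using assms(3) by (intro mult_left_mono)
      also have "\<dots> < e" using e assms(3) by (simp add: field_simps)
      finally show ?thesis using holdG[OF that(2,1)] by (simp add: dist_real_def)
    qed
    then show "\<exists>d>0. \<forall>x\<in>G. \<forall>x'\<in>G. dist x' x < d \<longrightarrow> dist (u x') (u x) < e"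
      using d by blast
  qed
  then obtain v where v: "uniformly_continuous_on (closure G) v" "\<And>x. x \<in> G \<Longrightarrow> u x = v x"
    using uniformly_continuous_on_extension_on_closure by metis
  have cont: "continuous_on (closure G) v"
    using v(1) uniformly_continuous_imp_continuous by blast
  \<comment> \<open>The estimate passes to the closure one variable at a time, by continuity in
    \<open>y\<close> first and in \<open>x\<close> afterwards.\<close>
  have half: "\<bar>v x - v y\<bar> \<le> L * norm (x - y) powr \<alpha>" if "x \<in> G" "y \<in> closure G" for x y
  proof -
    have "\<bar>v x - v y\<bar> - L * norm (x - y) powr \<alpha> \<le> 0"
    proof (rule continuous_le_on_closure[OF _ that(2)])
      show "continuous_on (closure G) (\<lambda>y. \<bar>v x - v y\<bar> - L * norm (x - y) powr \<alpha>)"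
        using assms(2) by (auto intro!: continuous_intros cont continuous_on_powr')
    qed (use holdG that(1) v(2) in auto)
    then show ?thesis by simp
  qed
  have "\<bar>v x - v y\<bar> \<le> L * norm (x - y) powr \<alpha>" if "x \<in> closure G" "y \<in> closure G" for x y
  proof -
    have "\<bar>v x - v y\<bar> - L * norm (x - y) powr \<alpha> \<le> 0"
    proof (rule continuous_le_on_closure[OF _ that(1)])
      show "continuous_on (closure G) (\<lambda>x. \<bar>v x - v y\<bar> - L * norm (x - y) powr \<alpha>)"
        using assms(2) by (auto intro!: continuous_intros cont continuous_on_powr')
    qed (use half that(2) in auto)
    then show ?thesis by simp
  qed
  moreover have "AE x in lebesgue_on \<Omega>. u x = v x"
    using AEG v(2) by auto
  ultimately show ?thesis using cont that unfolding clG by blast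
qed

section \<open>Equivalence classes and the limit functionals\<close>

lemma Lp_space_elem:
  assumes "U \<in> Lp_space \<Omega> q"
  shows "rep U \<in> U"
    and "u \<in> U \<Longrightarrow> u \<in> borel_measurable (lebesgue_on \<Omega>)"
    and "u \<in> U \<Longrightarrow> v \<in> U \<Longrightarrow> AE x in lebesgue_on \<Omega>. u x = v x"
    and "u \<in> U \<Longrightarrow> v \<in> borel_measurable (lebesgue_on \<Omega>) \<Longrightarrow>
      AE x in lebesgue_on \<Omega>. u x = v x \<Longrightarrow> v \<in> U"
proof -
  obtain w where w: "w \<in> borel_measurable (lebesgue_on \<Omega>)" and U: "U = ae_rel \<Omega> `` {w}"
    using assms unfolding Lp_space_def by (auto elim!: quotientE)
  have iff: "u \<in> U \<longleftrightarrow> u \<in> borel_measurable (lebesgue_on \<Omega>) \<and> (AE x in lebesgue_on \<Omega>. w x = u x)" for u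
    using w by (auto simp: U ae_rel_def)
  show "rep U \<in> U"
    unfolding rep_def by (rule someI[of _ w]) (use w iff in auto)
  show "u \<in> U \<Longrightarrow> u \<in> borel_measurable (lebesgue_on \<Omega>)" using iff by auto
  show "u \<in> U \<Longrightarrow> v \<in> U \<Longrightarrow> AE x in lebesgue_on \<Omega>. u x = v x"
    unfolding iff by auto
  show "u \<in> U \<Longrightarrow> v \<in> borel_measurable (lebesgue_on \<Omega>) \<Longrightarrow>
      AE x in lebesgue_on \<Omega>. u x = v x \<Longrightarrow> v \<in> U"
    unfolding iff by auto
qed

lemma holder_sup_cong:
  "(\<And>x. x \<in> S \<Longrightarrow> u x = v x) \<Longrightarrow> holder_sup \<alpha> S u = holder_sup \<alpha> S v"
  unfolding holder_sup_def by (intro SUP_cong) auto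

text \<open>The pairs with \<open>x = y\<close>, left out of the supremum, satisfy the right-hand
  inequality trivially, both sides being 0. The Hoelder condition can thus be used without
  division.\<close>

lemma holder_sup_le_iff:
  assumes "0 \<le> K"
  shows "holder_sup \<alpha> S u \<le> ennreal K \<longleftrightarrow> (\<forall>x\<in>S. \<forall>y\<in>S. \<bar>u x - u y\<bar> \<le> K * norm (x - y) powr \<alpha>)"
proof -
  have "ennreal (\<bar>u x - u y\<bar> / norm (x - y) powr \<alpha>) \<le> ennreal K \<longleftrightarrow>
      \<bar>u x - u y\<bar> \<le> K * norm (x - y) powr \<alpha>" if "x \<noteq> y" for x y
    using that assms by (simp add: divide_le_eq)
  then show ?thesis
    unfolding holder_sup_def SUP_le_iff by fastforce
qed

lemma E_inf_eq_holder_sup: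
  assumes "open \<Omega>" "U \<in> Lp_space \<Omega> q" "u \<in> U" "continuous_on \<Omega> u"
  shows "E_inf \<Omega> \<alpha> U = holder_sup \<alpha> \<Omega> u"
proof -
  define v where "v = (SOME u. u \<in> U \<and> continuous_on \<Omega> u)"
  have v: "v \<in> U" "continuous_on \<Omega> v"
    using someI[of "\<lambda>u. u \<in> U \<and> continuous_on \<Omega> u" u] assms by (auto simp: v_def)
  have "holder_sup \<alpha> \<Omega> v = holder_sup \<alpha> \<Omega> u"
    using AE_eq_continuous_imp_eq[OF assms(1) Lp_space_elem(3)[OF assms(2) v(1) assms(3)]] v assms(4)
    by (intro holder_sup_cong) auto
  then show ?thesis using assms unfolding E_inf_def v_def by auto
qed

lemma E_inf_bar_eq_holder_sup:
  assumes "open \<Omega>" "U \<in> Lp_space \<Omega> q" "u \<in> U" "continuous_on (closure \<Omega>) u"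
  shows "E_inf_bar \<Omega> \<alpha> U = holder_sup \<alpha> (closure \<Omega>) u"
proof -
  define v where "v = (SOME u. u \<in> U \<and> continuous_on (closure \<Omega>) u)"
  have v: "v \<in> U" "continuous_on (closure \<Omega>) v"
    using someI[of "\<lambda>u. u \<in> U \<and> continuous_on (closure \<Omega>) u" u] assms by (auto simp: v_def)
  have eq: "v x = u x" if "x \<in> \<Omega>" for x
    using AE_eq_continuous_imp_eq[OF assms(1) Lp_space_elem(3)[OF assms(2) v(1) assms(3)]] that
      continuous_on_subset[OF v(2) closure_subset] continuous_on_subset[OF assms(4) closure_subset]
    by blast
  \<comment> \<open>Agreement on \<open>\<Omega>\<close> carries over to the closure by density,
    boundary values included.\<close>
  have "v x - u x = 0" if "x \<in> closure \<Omega>" for x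
    by (rule continuous_constant_on_closure[OF _ _ that])
      (auto intro!: continuous_intros v(2) assms(4) simp: eq)
  then have "holder_sup \<alpha> (closure \<Omega>) v = holder_sup \<alpha> (closure \<Omega>) u"
    by (intro holder_sup_cong) auto
  then show ?thesis using assms unfolding E_inf_bar_def v_def by auto
qed

text \<open>The supremum over the closure runs over more pairs. The lower bound is proved for the
  larger functional and the upper bound for the smaller one; this comparison transfers each bound to
  the other functional.\<close>

lemma E_inf_le_E_inf_bar:
  assumes "open \<Omega>" "U \<in> Lp_space \<Omega> q"
  shows "E_inf \<Omega> \<alpha> U \<le> E_inf_bar \<Omega> \<alpha> U"
proof (cases "\<exists>u\<in>U. continuous_on (closure \<Omega>) u")
  case True
  then obtain u where u: "u \<in> U" "continuous_on (closure \<Omega>) u" by blast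
  then have "continuous_on \<Omega> u" using closure_subset continuous_on_subset by blast
  then have "E_inf \<Omega> \<alpha> U = holder_sup \<alpha> \<Omega> u"
    using E_inf_eq_holder_sup assms u(1) by blast
  also have "\<dots> \<le> holder_sup \<alpha> (closure \<Omega>) u"
    unfolding holder_sup_def using closure_subset[of \<Omega>] by (intro SUP_subset_mono) auto
  finally show ?thesis using E_inf_bar_eq_holder_sup[OF assms u] by simp
qed (simp add: E_inf_bar_def)

lemma E_inf_bar_le_if_AE_holder:
  fixes U :: "('a::euclidean_space \<Rightarrow> real) set"
  assumes "open \<Omega>" "0 < \<alpha>" "0 \<le> L" "U \<in> Lp_space \<Omega> q"
    and "AE x in lebesgue_on \<Omega>. AE y in lebesgue_on \<Omega>. \<bar>rep U x - rep U y\<bar> \<le> L * norm (x - y) powr \<alpha>"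
  shows "E_inf_bar \<Omega> \<alpha> U \<le> ennreal L"
proof -
  obtain v where v: "continuous_on (closure \<Omega>) v" "AE x in lebesgue_on \<Omega>. rep U x = v x"
    "\<And>x y. x \<in> closure \<Omega> \<Longrightarrow> y \<in> closure \<Omega> \<Longrightarrow> \<bar>v x - v y\<bar> \<le> L * norm (x - y) powr \<alpha>"
    using holder_AE_imp_extension[OF assms(1-3,5)] by metis
  have "v \<in> borel_measurable (lebesgue_on \<Omega>)"
    using continuous_on_subset[OF v(1) closure_subset] assms(1)
    by (intro continuous_imp_measurable_on_sets_lebesgue) auto
  then have "v \<in> U"
    using Lp_space_elem(1,4)[OF assms(4)] v(2) by blast
  then show ?thesis
    using E_inf_bar_eq_holder_sup[OF assms(1,4) _ v(1)] v(3) by (simp add: holder_sup_le_iff assms(3))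
qed

section \<open>Lebesgue norms and convergence in measure\<close>

text \<open>For finite exponents the elementary bound of \<open>\<bar>a - b\<bar> powr r\<close> by
  \<open>2 powr r\<close> times the sum of both powers replaces the triangle inequality; it holds
  for every \<open>r > 0\<close>. For \<open>q = \<infinity>\<close> the essential suprema
  add.\<close>

lemma Lp_norm_diff_finite:
  assumes [measurable]: "u \<in> borel_measurable (lebesgue_on \<Omega>)" "v \<in> borel_measurable (lebesgue_on \<Omega>)"
    and "0 < q" "Lp_norm \<Omega> q u < \<infinity>" "Lp_norm \<Omega> q v < \<infinity>"
  shows "Lp_norm \<Omega> q (\<lambda>x. u x - v x) < \<infinity>"
proof (cases "q = \<infinity>")
  case True
  let ?M = "lebesgue_on \<Omega>"
  have "AE x in ?M. ennreal \<bar>u x - v x\<bar> \<le> esssup ?M (\<lambda>x. ennreal \<bar>u x\<bar>) + esssup ?M (\<lambda>x. ennreal \<bar>v x\<bar>)"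
    using esssup_AE[of "\<lambda>x. ennreal \<bar>u x\<bar>" ?M] esssup_AE[of "\<lambda>x. ennreal \<bar>v x\<bar>" ?M]
  proof eventually_elim
    case (elim x)
    have "ennreal \<bar>u x - v x\<bar> \<le> ennreal (\<bar>u x\<bar> + \<bar>v x\<bar>)"
      by (intro ennreal_leI) linarith
    also have "\<dots> = ennreal \<bar>u x\<bar> + ennreal \<bar>v x\<bar>" by simp
    also have "\<dots> \<le> esssup ?M (\<lambda>x. ennreal \<bar>u x\<bar>) + esssup ?M (\<lambda>x. ennreal \<bar>v x\<bar>)"
      using elim by (rule add_mono)
    finally show ?case .
  qed
  then have "esssup ?M (\<lambda>x. ennreal \<bar>u x - v x\<bar>) \<le>
      esssup ?M (\<lambda>x. ennreal \<bar>u x\<bar>) + esssup ?M (\<lambda>x. ennreal \<bar>v x\<bar>)"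
    by (intro esssup_I) measurable
  also have "\<dots> < \<infinity>" using assms(4,5) True by (simp add: Lp_norm_def)
  finally show ?thesis using True by (simp add: Lp_norm_def)
next
  case False
  then obtain r where q: "q = ereal r" "0 < r" using assms(3) by (cases q) auto
  let ?I = "\<lambda>w. \<integral>\<^sup>+x. ennreal (\<bar>w x\<bar> powr r) \<partial>lebesgue_on \<Omega>"
  have fin: "Lp_norm \<Omega> q w < \<infinity> \<longleftrightarrow> ?I w < \<infinity>" for w
    by (auto simp: Lp_norm_def root_ennreal_def q less_top)
  have "\<bar>a - b\<bar> powr r \<le> 2 powr r * \<bar>a\<bar> powr r + 2 powr r * \<bar>b\<bar> powr r" for a b :: real
  proof -
    have "\<bar>a - b\<bar> powr r \<le> (2 * max \<bar>a\<bar> \<bar>b\<bar>) powr r"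
      using q by (intro powr_mono2) auto
    also have "\<dots> = 2 powr r * max \<bar>a\<bar> \<bar>b\<bar> powr r" by (simp add: powr_mult)
    also have "\<dots> \<le> 2 powr r * \<bar>a\<bar> powr r + 2 powr r * \<bar>b\<bar> powr r" by (simp add: max_def)
    finally show ?thesis .
  qed
  then have "?I (\<lambda>x. u x - v x) \<le>
      (\<integral>\<^sup>+x. ennreal (2 powr r) * ennreal (\<bar>u x\<bar> powr r) + ennreal (2 powr r) * ennreal (\<bar>v x\<bar> powr r) \<partial>lebesgue_on \<Omega>)"
    by (intro nn_integral_mono) (simp flip: ennreal_mult ennreal_plus)
  also have "\<dots> = ennreal (2 powr r) * ?I u + ennreal (2 powr r) * ?I v"
    by (simp add: nn_integral_add nn_integral_cmult)
  also have "\<dots> < \<infinity>"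
    using assms(4,5) unfolding fin by (simp add: ennreal_mult_less_top)
  finally show ?thesis unfolding fin .
qed

text \<open>\<open>enn2real\<close> sends infinity to 0, so a small \<open>Lp_dist\<close> says
  something about the norm only once the norm is known to be finite.\<close>

lemma Lp_norm_eq_Lp_dist:
  assumes "0 < q" "U \<in> Lp_space \<Omega> q" "V \<in> Lp_space \<Omega> q"
  shows "Lp_norm \<Omega> q (\<lambda>x. rep U x - rep V x) = ennreal (Lp_dist \<Omega> q U V)"
proof -
  have "Lp_norm \<Omega> q (\<lambda>x. rep U x - rep V x) < \<infinity>"
    using Lp_space_elem(1,2)[OF assms(2)] Lp_space_elem(1,2)[OF assms(3)] assms
    by (intro Lp_norm_diff_finite) (auto simp: Lp_space_def)
  then show ?thesis unfolding Lp_dist_def by (simp add: less_top)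
qed

lemma nn_integral_le_of_root_ennreal_le:
  assumes "root_ennreal p t \<le> ennreal K" "0 < p" "0 \<le> K"
  shows "t \<le> ennreal (K powr p)"
proof (cases t)
  case (real s)
  then have "s powr (1 / p) \<le> K" using assms by (simp add: root_ennreal_def)
  then have "(s powr (1 / p)) powr p \<le> K powr p" using assms by (intro powr_mono2) auto
  then show ?thesis using real assms by (simp add: powr_powr)
next
  case top
  then show ?thesis using assms by (simp add: root_ennreal_def top_unique)
qed

text \<open>Chebyshev's inequality for the power \<open>p\<close>. It serves twice: for convergence
  in measure, and for the Hoelder quotient, where \<open>K < K'\<close> lets the bound tend to 0 as
  \<open>p\<close> grows.\<close>

lemma emeasure_le_if_nn_integral_powr:
  assumes [measurable]: "f \<in> borel_measurable M" "A \<in> sets M"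
    and "(\<integral>\<^sup>+x. ennreal (f x powr p) \<partial>M) \<le> ennreal (K powr p)"
    and "0 < K'" "0 < p" "\<And>x. x \<in> A \<Longrightarrow> K' \<le> f x" "0 \<le> K"
  shows "emeasure M A \<le> ennreal ((K / K') powr p)"
proof -
  have "ennreal (K' powr p) * emeasure M A = (\<integral>\<^sup>+x. ennreal (K' powr p) * indicator A x \<partial>M)"
    by (simp add: nn_integral_cmult_indicator)
  also have "\<dots> \<le> (\<integral>\<^sup>+x. ennreal (f x powr p) \<partial>M)"
    using assms(4-6) by (intro nn_integral_mono) (auto simp: indicator_def intro!: powr_mono2)
  also note assms(3)
  finally have "ennreal (1 / K' powr p) * (ennreal (K' powr p) * emeasure M A) \<le>
      ennreal (1 / K' powr p) * ennreal (K powr p)"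
    by (rule mult_left_mono) simp
  then show ?thesis
    using assms(4,7) by (simp add: mult.assoc[symmetric] powr_divide flip: ennreal_mult)
qed

text \<open>Norm convergence implies convergence in measure, by Chebyshev's inequality for finite
  \<open>q\<close>. The radius \<open>\<rho>\<close> is independent of \<open>w\<close>, so it can
  be fixed before an index of the sequence is chosen.\<close>

lemma emeasure_small_if_Lp_norm_small:
  assumes "0 < q" "0 < \<delta>" "0 < \<eta>"
  obtains \<rho> where "0 < \<rho>"
    "\<And>w. w \<in> borel_measurable (lebesgue_on \<Omega>) \<Longrightarrow> Lp_norm \<Omega> q w \<le> ennreal \<rho> \<Longrightarrow>
      emeasure (lebesgue_on \<Omega>) {x\<in>space (lebesgue_on \<Omega>). \<delta> < \<bar>w x\<bar>} \<le> ennreal \<eta>"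
proof (cases "q = \<infinity>")
  case True
  \<comment> \<open>For \<open>q = \<infinity>\<close> the radius \<open>\<delta>\<close> itself
    works, and the set even has measure 0.\<close>
  have "emeasure (lebesgue_on \<Omega>) {x\<in>space (lebesgue_on \<Omega>). \<delta> < \<bar>w x\<bar>} \<le> ennreal \<eta>"
    if [measurable]: "w \<in> borel_measurable (lebesgue_on \<Omega>)" and small: "Lp_norm \<Omega> q w \<le> ennreal \<delta>" for w
  proof -
    have "AE x in lebesgue_on \<Omega>. \<not> \<delta> < \<bar>w x\<bar>"
      using esssup_AE[of "\<lambda>x. ennreal \<bar>w x\<bar>" "lebesgue_on \<Omega>"]
    proof eventually_elim
      case (elim x)
      then have "ennreal \<bar>w x\<bar> \<le> ennreal \<delta>"
        using small True by (simp add: Lp_norm_def)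
      then show ?case using assms(2) by simp
    qed
    moreover have "{x\<in>space (lebesgue_on \<Omega>). \<delta> < \<bar>w x\<bar>} \<in> sets (lebesgue_on \<Omega>)"
      by measurable
    ultimately have "emeasure (lebesgue_on \<Omega>) {x\<in>space (lebesgue_on \<Omega>). \<delta> < \<bar>w x\<bar>} = 0"
      by (subst (asm) AE_iff_measurable) auto
    then show ?thesis by simp
  qed
  then show ?thesis using that assms(2) by blast
next
  case False
  then obtain r where q: "q = ereal r" "0 < r" using assms(1) by (cases q) auto
  \<comment> \<open>Solves \<open>(\<rho> / \<delta>) powr r = \<eta>\<close>, the bound that
    Chebyshev's inequality yields.\<close>
  define \<rho> where "\<rho> = \<delta> * \<eta> powr (1 / r)"
  have \<rho>: "0 < \<rho>" using assms by (simp add: \<rho>_def)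
  have "emeasure (lebesgue_on \<Omega>) {x\<in>space (lebesgue_on \<Omega>). \<delta> < \<bar>w x\<bar>} \<le> ennreal \<eta>"
    if [measurable]: "w \<in> borel_measurable (lebesgue_on \<Omega>)" and small: "Lp_norm \<Omega> q w \<le> ennreal \<rho>" for w
  proof -
    have "(\<integral>\<^sup>+x. ennreal (\<bar>w x\<bar> powr r) \<partial>lebesgue_on \<Omega>) \<le> ennreal (\<rho> powr r)"
      using small q \<rho> by (intro nn_integral_le_of_root_ennreal_le) (auto simp: Lp_norm_def)
    moreover have "{x\<in>space (lebesgue_on \<Omega>). \<delta> < \<bar>w x\<bar>} \<in> sets (lebesgue_on \<Omega>)"
      by measurable
    ultimately have "emeasure (lebesgue_on \<Omega>) {x\<in>space (lebesgue_on \<Omega>). \<delta> < \<bar>w x\<bar>} \<le> ennreal ((\<rho> / \<delta>) powr r)"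
      using assms(2) q(2) \<rho> by (intro emeasure_le_if_nn_integral_powr[where f = "\<lambda>x. \<bar>w x\<bar>"]) auto
    also have "(\<rho> / \<delta>) powr r = \<eta>"
      using assms q by (simp add: \<rho>_def powr_powr)
    finally show ?thesis .
  qed
  then show ?thesis using that \<rho> by blast
qed

section \<open>The lower bound for the limit inferior\<close>

text \<open>Lets \<open>measurable\<close> handle \<open>norm (fst z - snd z)\<close> on the
  product, whose factors carry the Lebesgue sigma-algebra.\<close>

lemma measurable_lebesgue_on_ident [measurable]: "(\<lambda>x. x) \<in> borel_measurable (lebesgue_on \<Omega>)"
  by (intro measurable_restrict_space1 measurable_completion) simp

text \<open>With the exponent \<open>\<alpha> * p\<close> in the denominator, the integrand is
  exactly the power \<open>p\<close> of the \<alpha>-Hoelder quotient, to which Chebyshev's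
  inequality applies.\<close>

lemma emeasure_quotient_superlevel_le:
  fixes u :: "'a::euclidean_space \<Rightarrow> real"
  assumes [measurable]: "u \<in> borel_measurable (lebesgue_on \<Omega>)"
    and "root_ennreal p (double_integral \<Omega> p (\<alpha> * p) u) \<le> ennreal K"
    and "0 < p" "0 \<le> K" "0 < K'"
  defines "P \<equiv> lebesgue_on \<Omega> \<Otimes>\<^sub>M lebesgue_on \<Omega>"
  shows "emeasure P {z \<in> space P. K' * norm (fst z - snd z) powr \<alpha> < \<bar>u (fst z) - u (snd z)\<bar>}
    \<le> ennreal ((K / K') powr p)" (is "emeasure P ?A \<le> _")
proof -
  let ?f = "\<lambda>z. \<bar>u (fst z) - u (snd z)\<bar> / norm (fst z - snd z) powr \<alpha>"
  have "double_integral \<Omega> p (\<alpha> * p) u = (\<integral>\<^sup>+z. ennreal (?f z powr p) \<partial>P)"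
    by (simp add: double_integral_def P_def case_prod_unfold powr_divide powr_powr)
  then have "(\<integral>\<^sup>+z. ennreal (?f z powr p) \<partial>P) \<le> ennreal (K powr p)"
    using nn_integral_le_of_root_ennreal_le[OF assms(2-4)] by simp
  then show ?thesis
  proof (rule emeasure_le_if_nn_integral_powr[rotated 2])
    show "?f \<in> borel_measurable P" "?A \<in> sets P" unfolding P_def by measurable
    fix z assume z: "z \<in> ?A"
    \<comment> \<open>On the diagonal both sides of the strict inequality defining \<open>?A\<close>
      are 0. Off it, the denominator is positive.\<close>
    then have "fst z \<noteq> snd z" by auto
    then show "K' \<le> ?f z" using z by (simp add: le_divide_eq)
  qed (use assms in auto)
qed


lemma powr_tendsto_0_at_top:
  fixes b :: real
  assumes "0 < b" "b < 1"
  shows "((\<lambda>x. b powr x) \<longlongrightarrow> 0) at_top"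
proof -
  have "filterlim (\<lambda>x. ln b * x) at_bot at_top"
    by (rule filterlim_tendsto_neg_mult_at_bot[OF tendsto_const _ filterlim_ident]) (use assms in simp)
  from filterlim_compose[OF exp_at_bot this] show ?thesis
    using assms by (simp add: powr_def mult.commute)
qed

text \<open>A single index at which the energy is below \<open>K\<close>, the distance is small and
  \<open>(K / K') powr p n\<close> is small already makes the bad set of \<open>U\<close> small.
  Therefore a bound for infinitely many indices suffices.\<close>

lemma AE_holder_if_frequently_E_fun_less:
  fixes \<Omega> :: "'a::euclidean_space set"
  assumes "open \<Omega>" "bounded \<Omega>" "0 < q" "U \<in> Lp_space \<Omega> q" "\<And>n. V n \<in> Lp_space \<Omega> q"
    and lim: "(\<lambda>n. Lp_dist \<Omega> q (V n) U) \<longlonglongrightarrow> 0"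
    and p: "\<And>n. 0 < p n" "filterlim p at_top sequentially"
    and freq: "\<exists>\<^sub>F n in sequentially. E_fun \<Omega> \<alpha> (p n) (V n) < ennreal K"
    and K: "0 < K" "K < K'"
  defines "P \<equiv> lebesgue_on \<Omega> \<Otimes>\<^sub>M lebesgue_on \<Omega>"
  shows "AE z in P. \<bar>rep U (fst z) - rep U (snd z)\<bar> \<le> K' * norm (fst z - snd z) powr \<alpha>"
proof -
  let ?M = "lebesgue_on \<Omega>"
  interpret M: finite_measure ?M
    using assms(1,2) by (intro finite_measure_lebesgue_on) (simp add: lmeasurable_open)
  have U[measurable]: "rep U \<in> borel_measurable ?M"
    using Lp_space_elem(1,2) assms(4) by blast
  have V[measurable]: "rep (V n) \<in> borel_measurable ?M" for n
    using Lp_space_elem(1,2) assms(5) by blast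
  define c where "c = measure ?M (space ?M)"
  have c: "emeasure ?M (space ?M) = ennreal c" "0 \<le> c"
    by (simp_all add: c_def M.emeasure_eq_measure)
  have powr0: "(\<lambda>n. (K / K') powr p n) \<longlonglongrightarrow> 0"
    by (rule filterlim_compose[OF powr_tendsto_0_at_top p(2)]) (use K in auto)
  \<comment> \<open>The slack \<open>2 * \<delta>\<close> pays for replacing \<open>U\<close> by
    \<open>V n\<close> at both points of a pair.\<close>
  have AE_\<delta>: "AE z in P. \<not> K' * norm (fst z - snd z) powr \<alpha> + 2 * \<delta> < \<bar>rep U (fst z) - rep U (snd z)\<bar>"
    if "0 < \<delta>" for \<delta>
  proof -
    define B where "B = {z \<in> space P. K' * norm (fst z - snd z) powr \<alpha> + 2 * \<delta> < \<bar>rep U (fst z) - rep U (snd z)\<bar>}"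
    have [measurable]: "B \<in> sets P" unfolding B_def P_def by measurable
    \<comment> \<open>The summand 0 fits the shape of \<open>ennreal_le_epsilon\<close>, which then
      gives measure 0.\<close>
    have "emeasure P B \<le> 0 + ennreal e" if e: "0 < e" for e
    proof -
      \<comment> \<open>\<open>B\<close> will be covered by \<open>A\<close>, of measure at most
        \<open>\<eta>\<close>, and two strips over \<open>D\<close>, each of measure at most
        \<open>\<eta> * c\<close>.\<close>
      define \<eta> where "\<eta> = e / (1 + 2 * c)"
      have \<eta>: "0 < \<eta>" using e c by (simp add: \<eta>_def)
      obtain \<rho> where \<rho>: "0 < \<rho>"
        "\<And>w. w \<in> borel_measurable ?M \<Longrightarrow> Lp_norm \<Omega> q w \<le> ennreal \<rho> \<Longrightarrow>
          emeasure ?M {x\<in>space ?M. \<delta> < \<bar>w x\<bar>} \<le> ennreal \<eta>"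
        using emeasure_small_if_Lp_norm_small[OF assms(3) \<open>0 < \<delta>\<close> \<eta>] by metis
      have "\<forall>\<^sub>F n in sequentially. Lp_dist \<Omega> q (V n) U < \<rho> \<and> (K / K') powr p n < \<eta>"
        using order_tendstoD(2)[OF lim \<rho>(1)] order_tendstoD(2)[OF powr0 \<eta>] by (rule eventually_conj)
      from frequently_ex[OF frequently_eventually_conj[OF freq this]]
      obtain n where n: "E_fun \<Omega> \<alpha> (p n) (V n) < ennreal K" "Lp_dist \<Omega> q (V n) U < \<rho>"
        "(K / K') powr p n < \<eta>"
        by blast
      define A where "A = {z \<in> space P. K' * norm (fst z - snd z) powr \<alpha> < \<bar>rep (V n) (fst z) - rep (V n) (snd z)\<bar>}"
      define D where "D = {x\<in>space ?M. \<delta> < \<bar>rep (V n) x - rep U x\<bar>}"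
      have [measurable]: "A \<in> sets P" unfolding A_def P_def by measurable
      have D[measurable]: "D \<in> sets ?M" unfolding D_def by measurable
      have "emeasure P A \<le> ennreal ((K / K') powr p n)"
        unfolding A_def P_def
        \<comment> \<open>A finite energy rules out the infinite branch of \<open>E_fun\<close>,
          leaving the root of the double integral.\<close>
        by (rule emeasure_quotient_superlevel_le) (use n(1) K p(1) in \<open>auto simp: E_fun_def less_imp_le split: if_splits\<close>)
      also have "\<dots> \<le> ennreal \<eta>" using n(3) by (intro ennreal_leI) simp
      finally have A: "emeasure P A \<le> ennreal \<eta>" .
      have emD: "emeasure ?M D \<le> ennreal \<eta>"
        unfolding D_def using Lp_norm_eq_Lp_dist[OF assms(3,5,4)] n(2)
        by (intro \<rho>(2)) (auto intro!: ennreal_leI)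
      have "emeasure P (D \<times> space ?M) = emeasure ?M D * ennreal c"
        "emeasure P (space ?M \<times> D) = ennreal c * emeasure ?M D"
        unfolding P_def c(1)[symmetric] using D
        by (auto intro!: M.emeasure_pair_measure_Times)
      then have DM: "emeasure P (D \<times> space ?M) \<le> ennreal (\<eta> * c)"
        "emeasure P (space ?M \<times> D) \<le> ennreal (\<eta> * c)"
        using mult_right_mono[OF emD, of "ennreal c"] \<eta> c(2)
        by (auto simp: ennreal_mult mult.commute)
      have "B \<subseteq> A \<union> D \<times> space ?M \<union> space ?M \<times> D"
      proof
        fix z assume z: "z \<in> B"
        show "z \<in> A \<union> D \<times> space ?M \<union> space ?M \<times> D"
        proof (rule ccontr)
          assume "z \<notin> A \<union> D \<times> space ?M \<union> space ?M \<times> D"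
          then have "\<bar>rep (V n) (fst z) - rep (V n) (snd z)\<bar> \<le> K' * norm (fst z - snd z) powr \<alpha>"
            "\<bar>rep (V n) (fst z) - rep U (fst z)\<bar> \<le> \<delta>" "\<bar>rep (V n) (snd z) - rep U (snd z)\<bar> \<le> \<delta>"
            using z by (auto simp: A_def B_def D_def P_def space_pair_measure)
          then show False using z unfolding B_def mem_Collect_eq by linarith
        qed
      qed
      then have "emeasure P B \<le> emeasure P (A \<union> D \<times> space ?M \<union> space ?M \<times> D)"
        by (intro emeasure_mono) (auto simp: P_def intro!: pair_measureI sets.Un \<open>A \<in> sets P\<close>[unfolded P_def])
      also have "\<dots> \<le> emeasure P A + emeasure P (D \<times> space ?M) + emeasure P (space ?M \<times> D)"
        by (intro order_trans[OF emeasure_subadditive] add_mono order_refl)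
          (auto simp: P_def intro!: pair_measureI sets.Un \<open>A \<in> sets P\<close>[unfolded P_def])
      also have "\<dots> \<le> ennreal \<eta> + ennreal (\<eta> * c) + ennreal (\<eta> * c)"
        by (intro add_mono A DM)
      also have "\<dots> = ennreal (\<eta> * (1 + 2 * c))"
        using \<eta> c(2) by (simp add: algebra_simps flip: ennreal_plus)
      also have "\<eta> * (1 + 2 * c) = e" using c(2) by (simp add: \<eta>_def)
      finally show ?thesis by simp
    qed
    then have "emeasure P B = 0"
      using ennreal_le_epsilon[of 0 "emeasure P B"] by simp
    then show ?thesis
      by (subst AE_iff_measurable[OF \<open>B \<in> sets P\<close>]) (auto simp: B_def)
  qed
  \<comment> \<open>Countably many values of \<open>\<delta>\<close> share one null set, outside
    which the slack can tend to 0.\<close>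
  have "AE z in P. \<forall>k. \<not> K' * norm (fst z - snd z) powr \<alpha> + 2 * inverse (real (Suc k)) < \<bar>rep U (fst z) - rep U (snd z)\<bar>"
    unfolding AE_all_countable by (intro allI AE_\<delta>) simp
  then show ?thesis
  proof (rule AE_mp, intro AE_I2 impI)
    fix z assume *: "\<forall>k. \<not> K' * norm (fst z - snd z) powr \<alpha> + 2 * inverse (real (Suc k)) < \<bar>rep U (fst z) - rep U (snd z)\<bar>"
    have "(\<lambda>k. K' * norm (fst z - snd z) powr \<alpha> + 2 * inverse (real (Suc k))) \<longlonglongrightarrow>
        K' * norm (fst z - snd z) powr \<alpha> + 2 * 0"
      by (intro tendsto_intros LIMSEQ_inverse_real_of_nat)
    then show "\<bar>rep U (fst z) - rep U (snd z)\<bar> \<le> K' * norm (fst z - snd z) powr \<alpha>"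
      using * by (intro LIMSEQ_le_const) (auto simp: not_less)
  qed
qed

text \<open>Only a finite limit inferior \<open>l\<close> needs an argument. The almost-everywhere
  Hoelder condition then holds with every constant above \<open>l\<close>, hence with
  \<open>l\<close>, and the extension lemma carries it to the closure.\<close>

lemma E_inf_bar_le_liminf_E_fun:
  fixes \<Omega> :: "'a::euclidean_space set"
  assumes "open \<Omega>" "bounded \<Omega>" "0 < \<alpha>" "0 < q" "U \<in> Lp_space \<Omega> q" "\<And>n. V n \<in> Lp_space \<Omega> q"
    and "(\<lambda>n. Lp_dist \<Omega> q (V n) U) \<longlonglongrightarrow> 0"
    and "\<And>n. 0 < p n" "filterlim p at_top sequentially"
  shows "E_inf_bar \<Omega> \<alpha> U \<le> liminf (\<lambda>n. E_fun \<Omega> \<alpha> (p n) (V n))" (is "_ \<le> ?L")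
proof (cases "?L")
  case (real l)
  let ?M = "lebesgue_on \<Omega>"
  interpret M: finite_measure ?M
    using assms(1,2) by (intro finite_measure_lebesgue_on) (simp add: lmeasurable_open)
  interpret P: pair_sigma_finite ?M ?M ..
  \<comment> \<open>Here \<open>K = l + \<epsilon>\<close> and
    \<open>K' = l + 2 * \<epsilon>\<close>. Energies eventually at least
    \<open>l + \<epsilon>\<close> would push the limit inferior above \<open>l\<close>.\<close>
  have AE_\<epsilon>: "AE z in ?M \<Otimes>\<^sub>M ?M. \<bar>rep U (fst z) - rep U (snd z)\<bar> \<le> (l + 2 * \<epsilon>) * norm (fst z - snd z) powr \<alpha>"
    if \<epsilon>: "0 < \<epsilon>" for \<epsilon>
  proof (rule AE_holder_if_frequently_E_fun_less[OF assms(1,2,4-9)])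
    show "\<exists>\<^sub>F n in sequentially. E_fun \<Omega> \<alpha> (p n) (V n) < ennreal (l + \<epsilon>)"
    proof (rule ccontr)
      assume "\<not> ?thesis"
      then have "ennreal (l + \<epsilon>) \<le> ?L"
        by (intro Liminf_bounded) (simp add: not_frequently not_less)
      then show False using real \<epsilon> by simp
    qed
  qed (use real \<epsilon> in auto)
  have "AE z in ?M \<Otimes>\<^sub>M ?M. \<forall>k. \<bar>rep U (fst z) - rep U (snd z)\<bar> \<le>
      (l + 2 * inverse (real (Suc k))) * norm (fst z - snd z) powr \<alpha>"
    unfolding AE_all_countable by (intro allI AE_\<epsilon>) simp
  then have "AE z in ?M \<Otimes>\<^sub>M ?M. \<bar>rep U (fst z) - rep U (snd z)\<bar> \<le> l * norm (fst z - snd z) powr \<alpha>"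
  proof (rule AE_mp, intro AE_I2 impI)
    fix z assume *: "\<forall>k. \<bar>rep U (fst z) - rep U (snd z)\<bar> \<le>
      (l + 2 * inverse (real (Suc k))) * norm (fst z - snd z) powr \<alpha>"
    have "(\<lambda>k. (l + 2 * inverse (real (Suc k))) * norm (fst z - snd z) powr \<alpha>) \<longlonglongrightarrow>
        (l + 2 * 0) * norm (fst z - snd z) powr \<alpha>"
      by (intro tendsto_intros LIMSEQ_inverse_real_of_nat)
    then show "\<bar>rep U (fst z) - rep U (snd z)\<bar> \<le> l * norm (fst z - snd z) powr \<alpha>"
      using * by (intro LIMSEQ_le_const) auto
  qed
  \<comment> \<open>Fubini turns almost every pair into almost every \<open>y\<close> for almost
    every \<open>x\<close>, the form the extension requires.\<close>
  from P.AE_pair[OF this] show ?thesis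
    unfolding real(2) using real(1) by (intro E_inf_bar_le_if_AE_holder[OF assms(1,3) _ assms(5)]) auto
qed simp

section \<open>The upper bound along constant sequences\<close>

text \<open>The integrand is at most \<open>K powr p\<close> almost everywhere on a product of
  finite measure, and the root turns that measure into a factor close to 1 for large
  \<open>p\<close>. Adding 1 to the measure of \<open>\<Omega>\<close> keeps the base
  positive.\<close>

lemma E_fun_le_of_holder:
  fixes \<Omega> :: "'a::euclidean_space set"
  assumes "open \<Omega>" "bounded \<Omega>" "0 < \<alpha>" "0 \<le> K" "0 < p" "U \<in> Lp_space \<Omega> q" "u \<in> U"
    and hold: "\<And>x y. x \<in> \<Omega> \<Longrightarrow> y \<in> \<Omega> \<Longrightarrow> \<bar>u x - u y\<bar> \<le> K * norm (x - y) powr \<alpha>"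
  shows "E_fun \<Omega> \<alpha> p U \<le> ennreal (K * (measure lebesgue \<Omega> + 1) powr (2 / p))"
proof -
  let ?M = "lebesgue_on \<Omega>"
  interpret M: finite_measure ?M
    using assms(1,2) by (intro finite_measure_lebesgue_on) (simp add: lmeasurable_open)
  interpret P: pair_sigma_finite ?M ?M ..
  have [measurable]: "rep U \<in> borel_measurable ?M" "u \<in> borel_measurable ?M"
    using Lp_space_elem(1,2)[OF assms(6)] assms(7) by blast+
  have ae: "AE x in ?M. rep U x = u x"
    using Lp_space_elem(1,3)[OF assms(6)] assms(7) by blast
  define c where "c = measure lebesgue \<Omega> + 1"
  have c: "emeasure ?M (space ?M) \<le> ennreal c" "0 < c"
    using assms(1) by (auto simp: c_def M.emeasure_eq_measure measure_restrict_space add_nonneg_pos)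
  \<comment> \<open>A Hoelder function on a bounded set is bounded. This puts \<open>U\<close> into
    the space with exponent \<open>p\<close>, although it is given in the one with exponent
    \<open>q\<close>.\<close>
  obtain B where B: "0 \<le> B" "\<And>x. x \<in> \<Omega> \<Longrightarrow> \<bar>u x\<bar> \<le> B"
  proof (cases "\<Omega> = {}")
    case False
    then obtain x0 where x0: "x0 \<in> \<Omega>" by blast
    obtain d where d: "\<And>x y. x \<in> \<Omega> \<Longrightarrow> y \<in> \<Omega> \<Longrightarrow> dist x y \<le> d"
      using bounded_two_points[of \<Omega>] assms(2) by blast
    have "\<bar>u x\<bar> \<le> \<bar>u x0\<bar> + K * d powr \<alpha>" if "x \<in> \<Omega>" for x
    proof -
      have "K * norm (x - x0) powr \<alpha> \<le> K * d powr \<alpha>"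
        using assms(3,4) d[OF that x0] by (intro mult_left_mono powr_mono2) (auto simp: dist_norm)
      then show ?thesis using hold[OF that x0] by linarith
    qed
    then show ?thesis using that[of "\<bar>u x0\<bar> + K * d powr \<alpha>"] assms(4) by simp
  qed (use that[of 0] in auto)
  have "(\<integral>\<^sup>+x. ennreal (\<bar>rep U x\<bar> powr p) \<partial>?M) \<le> (\<integral>\<^sup>+x. ennreal (B powr p) \<partial>?M)"
  proof (rule nn_integral_mono_AE)
    show "AE x in ?M. ennreal (\<bar>rep U x\<bar> powr p) \<le> ennreal (B powr p)"
      using ae AE_space[of ?M]
      by eventually_elim (use B assms(5) in \<open>auto intro!: ennreal_leI powr_mono2\<close>)
  qed
  also have "\<dots> < \<infinity>"
    by (simp add: ennreal_mult_less_top M.emeasure_eq_measure)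
  finally have "Lp_norm \<Omega> (ereal p) (rep U) < \<infinity>"
    by (auto simp: Lp_norm_def root_ennreal_def less_top)
  then have Lp: "U \<in> Lp_space \<Omega> (ereal p)"
    using assms(6) by (simp add: Lp_space_def)
  have "AE x in ?M. AE y in ?M. rep U (fst (x, y)) = u (fst (x, y)) \<and> rep U (snd (x, y)) = u (snd (x, y))"
    using ae by eventually_elim (use ae in auto)
  then have aeP: "AE z in ?M \<Otimes>\<^sub>M ?M. rep U (fst z) = u (fst z) \<and> rep U (snd z) = u (snd z)"
    by (rule P.AE_pair_measure[rotated]) measurable
  have I: "double_integral \<Omega> p (\<alpha> * p) (rep U) \<le> ennreal ((K * c powr (2 / p)) powr p)"
  proof -
    have "double_integral \<Omega> p (\<alpha> * p) (rep U) \<le> (\<integral>\<^sup>+z. ennreal (K powr p) \<partial>(?M \<Otimes>\<^sub>M ?M))"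
      unfolding double_integral_def case_prod_unfold
    proof (rule nn_integral_mono_AE)
      show "AE z in ?M \<Otimes>\<^sub>M ?M. ennreal (\<bar>rep U (fst z) - rep U (snd z)\<bar> powr p / norm (fst z - snd z) powr (\<alpha> * p))
          \<le> ennreal (K powr p)"
        using aeP AE_space[of "?M \<Otimes>\<^sub>M ?M"]
      proof eventually_elim
        case (elim z)
        show ?case
        proof (cases "fst z = snd z")
          case False
          have "\<bar>u (fst z) - u (snd z)\<bar> powr p \<le> (K * norm (fst z - snd z) powr \<alpha>) powr p"
            using elim(2) assms(5) by (intro powr_mono2 hold) (auto simp: space_pair_measure)
          also have "\<dots> = K powr p * norm (fst z - snd z) powr (\<alpha> * p)"
            by (simp add: powr_mult powr_powr)
          finally show ?thesis
            using elim(1) False by (intro ennreal_leI) (simp add: divide_le_eq)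
        qed simp
      qed
    qed
    also have "\<dots> = ennreal (K powr p) * (emeasure ?M (space ?M) * emeasure ?M (space ?M))"
      by (simp add: space_pair_measure M.emeasure_pair_measure_Times del: space_restrict_space)
    also have "\<dots> \<le> ennreal (K powr p) * (ennreal c * ennreal c)"
      by (intro mult_mono c) auto
    also have "\<dots> = ennreal ((K * c powr (2 / p)) powr p)"
      using c(2) assms(5) by (simp add: powr_mult powr_powr power2_eq_square flip: ennreal_mult)
    finally show ?thesis .
  qed
  \<comment> \<open>The Sobolev seminorm and the functional therefore involve the same double
    integral, and the bound \<open>I\<close> serves both.\<close>
  have exponent: "real DIM('a) + (\<alpha> - real DIM('a) / p) * p = \<alpha> * p"
    using assms(5) by (simp add: field_simps)
  have "U \<in> frac_sobolev \<Omega> (\<alpha> - real DIM('a) / p) p"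
    unfolding frac_sobolev_def exponent using Lp order_le_less_trans[OF I, of \<infinity>] by simp
  moreover have "root_ennreal p (double_integral \<Omega> p (\<alpha> * p) (rep U)) \<le> ennreal (K * c powr (2 / p))"
  proof (cases "double_integral \<Omega> p (\<alpha> * p) (rep U)")
    case (real t)
    then have "t powr (1 / p) \<le> ((K * c powr (2 / p)) powr p) powr (1 / p)"
      using I assms(5) by (intro powr_mono2) auto
    also have "\<dots> = K * c powr (2 / p)"
      using assms(4,5) by (simp add: powr_powr)
    finally show ?thesis using real by (auto simp: root_ennreal_def intro: ennreal_leI)
  qed (use I in \<open>simp add: top_unique\<close>)
  ultimately show ?thesis by (simp add: E_fun_def c_def)
qed

text \<open>For finite \<open>E_inf\<close> the preceding bound applies to the continuous
  representative with the optimal constant, and its factor \<open>c powr (2 / p n)\<close> tends to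
  1.\<close>

lemma limsup_E_fun_le_E_inf:
  fixes \<Omega> :: "'a::euclidean_space set"
  assumes "open \<Omega>" "bounded \<Omega>" "0 < \<alpha>" "U \<in> Lp_space \<Omega> q"
    and p: "\<And>n. 0 < p n" "filterlim p at_top sequentially"
  shows "limsup (\<lambda>n. E_fun \<Omega> \<alpha> (p n) U) \<le> E_inf \<Omega> \<alpha> U"
proof (cases "E_inf \<Omega> \<alpha> U")
  case (real K)
  then obtain u where u: "u \<in> U" "continuous_on \<Omega> u"
    unfolding E_inf_def by (auto split: if_splits)
  then have "holder_sup \<alpha> \<Omega> u = ennreal K"
    using E_inf_eq_holder_sup[OF assms(1,4)] real by metis
  then have hold: "\<bar>u x - u y\<bar> \<le> K * norm (x - y) powr \<alpha>" if "x \<in> \<Omega>" "y \<in> \<Omega>" for x y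
    using holder_sup_le_iff[OF real(1), of \<alpha> \<Omega> u] that by simp
  define c where "c = measure lebesgue \<Omega> + 1"
  have c: "0 < c" by (simp add: c_def add_nonneg_pos)
  have "(\<lambda>n. 2 / p n) \<longlonglongrightarrow> 0"
    by (rule tendsto_divide_0[OF tendsto_const filterlim_at_top_imp_at_infinity[OF p(2)]])
  then have "(\<lambda>n. ennreal (K * c powr (2 / p n))) \<longlonglongrightarrow> ennreal (K * c powr 0)"
    by (intro tendsto_intros) (use c in auto)
  then have "limsup (\<lambda>n. ennreal (K * c powr (2 / p n))) = ennreal K"
    using c by (intro lim_imp_Limsup) auto
  moreover have "limsup (\<lambda>n. E_fun \<Omega> \<alpha> (p n) U) \<le> limsup (\<lambda>n. ennreal (K * c powr (2 / p n)))"
    unfolding c_def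
    by (intro Limsup_mono always_eventually allI
      E_fun_le_of_holder[OF assms(1-3) real(1) p(1) assms(4) u(1)] hold)
  ultimately show ?thesis using real by simp
qed simp

section \<open>Gamma-convergence to both functionals\<close>

text \<open>\<open>E_inf\<close> lies below \<open>E_inf_bar\<close>, which lies below every limit
  inferior, while the limit superior along the constant sequence lies below \<open>E_inf\<close>.
  This chain contains both conditions for both functionals.\<close>

lemma Gamma_converges_E_fun:
  fixes \<Omega> :: "'a::euclidean_space set"
  assumes "open \<Omega>" "bounded \<Omega>" "0 < \<alpha>" "0 < q"
    and "\<And>n. 0 < p n" "filterlim p at_top sequentially"
  shows "Gamma_converges (Lp_space \<Omega> q) (Lp_dist \<Omega> q) (\<lambda>n. E_fun \<Omega> \<alpha> (p n)) (E_inf \<Omega> \<alpha>)"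
    and "Gamma_converges (Lp_space \<Omega> q) (Lp_dist \<Omega> q) (\<lambda>n. E_fun \<Omega> \<alpha> (p n)) (E_inf_bar \<Omega> \<alpha>)"
proof -
  have dist0: "Lp_dist \<Omega> q U U = 0" if "U \<in> Lp_space \<Omega> q" for U
    using assms(4) by (auto simp: Lp_dist_def Lp_norm_def root_ennreal_def
      intro!: antisym[OF enn2real_leI] esssup_I)
  note liminf = E_inf_bar_le_liminf_E_fun[OF assms(1-4) _ _ _ assms(5,6)]
  note limsup = limsup_E_fun_le_E_inf[OF assms(1-3) _ assms(5,6)]
  note le = E_inf_le_E_inf_bar[OF assms(1), of _ q \<alpha>]
  show "Gamma_converges (Lp_space \<Omega> q) (Lp_dist \<Omega> q) (\<lambda>n. E_fun \<Omega> \<alpha> (p n)) (E_inf \<Omega> \<alpha>)"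
    unfolding Gamma_converges_def
  proof (intro conjI ballI allI impI, goal_cases)
    case (1 U V)
    then show ?case using order_trans[OF le liminf] by blast
  next
    case (2 U)
    then show ?case using limsup dist0 by (intro exI[of _ "\<lambda>_. U"]) auto
  qed
  show "Gamma_converges (Lp_space \<Omega> q) (Lp_dist \<Omega> q) (\<lambda>n. E_fun \<Omega> \<alpha> (p n)) (E_inf_bar \<Omega> \<alpha>)"
    unfolding Gamma_converges_def
  proof (intro conjI ballI allI impI, goal_cases)
    case (1 U V)
    then show ?case using liminf by blast
  next
    case (2 U)
    then show ?case using order_trans[OF limsup le] dist0 by (intro exI[of _ "\<lambda>_. U"]) auto
  qed
qed

theorem theorem2p3:
  fixes \<Omega> :: "'a::euclidean_space set" and \<alpha> :: real and p :: "nat \<Rightarrow> real"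
  assumes "0 < \<alpha>" and "\<alpha> < 1"
    and "bounded_lipschitz_domain \<Omega>"
    and "strict_mono p"
    and "\<And>n. p n > real DIM('a) / \<alpha>"
    and "filterlim p at_top sequentially"
  shows "(\<forall>q::ereal. q > ereal (real DIM('a) / \<alpha>) \<longrightarrow>
           Gamma_converges (Lp_space \<Omega> q) (Lp_dist \<Omega> q) (\<lambda>n. E_fun \<Omega> \<alpha> (p n)) (E_inf \<Omega> \<alpha>)) \<and>
         (\<forall>q::ereal. q > ereal (2 * real DIM('a) / \<alpha>) \<longrightarrow>
           Gamma_converges (Lp_space \<Omega> q) (Lp_dist \<Omega> q) (\<lambda>n. E_fun \<Omega> \<alpha> (p n)) (E_inf_bar \<Omega> \<alpha>))"
proof -
  have \<Omega>: "open \<Omega>" "bounded \<Omega>"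
    using assms(3) by (auto simp: bounded_lipschitz_domain_def is_domain_def)
  have p: "0 < p n" for n
    using order_le_less_trans[OF _ assms(5), of 0 n] assms(1) by simp
  have q: "0 < q" if "ereal r < q" "0 \<le> r" for q r
    using that by (metis ereal_less_eq(5) order_le_less_trans)
  show ?thesis
    using assms(1) by (intro conjI allI impI Gamma_converges_E_fun[OF \<Omega> assms(1) q p assms(6)]) auto
qed

end
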